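(* Suppose that every student submits a weak partial order $P$ of her true preference $Q$ and that the matching satisfies both cutoff characterizations $\mu=Q(B(\mathbf S))$ and $\mu=P(B(\mathbf S))$. Fix a school $j$ with cutoff $c_j$, and consider a student with scores $\mathbf S=(S_j,\mathbf S_{-j})$ and submitted list $P$; write $(a,b)=P_j$, and define the sets of unlisted feasible schools $$N_j^+=B_j^+(\mathbf S)\setminus(P\cup\{0\}),\qquad N_j^-=B_j^-(\mathbf S)\setminus(P\cup\{0\}).$$ (1) The true local preference $Q_j$ of this student belongs to the set $$\mathbf Q_j=\begin{cases}\{(a,b)\}, & \text{if } S_j\ge c_j \text{ and } a=b,\\ \{(a,b)\}\cup(\{a\}\times N_j^-), & \text{if } S_j\ge c_j\text{ and } a\ne b,\\ \{(a,b)\}\cup\big((N_j^+\setminus N_j^-)\times\{b\}\big), & \text{if } S_j<c_j.\end{cases}$$ (2) If moreover $P$ is a strong partial order of $Q$, then $Q_j$ belongs to the set $$\mathbf Q_j=\begin{cases}\{(a,b)\}, & \text{if } |P|<K,\text{ or if } |P|=K,\ S_j\ge c_j \text{ and } a=b,\\ \{(a,b)\}\cup(\{a\}\times N_j^-), & \text{if } |P|=K,\ S_j\ge c_j\text{ and } a\ne b,\\ \{(a,b)\}\cup\big((N_j^+\setminus N_j^-)\times\{b\}\big), & \text{if } |P|=K\text{ and } S_j<c_j.\end{cases}$$ (3) The characterization in (1) is sharp if the distribution of $Q$ conditional on $P$ and $\mathbf S$ has full support, i.e. every $Q\in\mathcal Q$ such that $P$ is a weak partial order of $Q$ and $Q(B(\mathbf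 S))=P(B(\mathbf S))$ is in that support. Likewise, the characterization in (2) is sharp if every $Q\in\mathcal Q$ such that $P$ is a strong partial order of $Q$ and $Q(B(\mathbf S))=P(B(\mathbf S))$ is in the support of the distribution of $Q$ conditional on $P$ and $\mathbf S$.
   Context: Setting. $\mathcal J=\{1,\dots,J\}$ is a finite set of schools and $\mathcal J^0=\mathcal J\cup\{0\}$, where $0$ is the outside option. $(\Omega,\mathbb P)$ is a probability space of students. Each student has a strict preference relation (strict linear order) $Q$ on $\mathcal J^0$ ranking at least one school above $0$ ($\mathcal Q$ is the set of all such relations; schools ranked above $0$ are called acceptable), a vector of placement scores $\mathbf S=(S_1,\dots,S_J)\in\mathbb R^J$, and a submitted list $P$, which is an ordered list of distinct schools with $1\le|P|\le K$, where $K<J$ is a fixed cap. There are fixed cutoffs $c_1,\dots,c_J$. The list $P$ is also regarded as a set of schools. Every student's match is $\mu\in\mathcal J^0$. Weak partial order: $P$ is a weak partial order of $Q$ if (i) $1\le |P|\le K$ and $P\subseteq\{d:d\,Q\,0\}$, and (ii) for all $d,d'\in P$, $d'$ is ranked above $d$ in $P$ iff $d'\,Q\,d$. Strong partial order: in addition (iii) $|P|=\min\{K,|\{d:d\,Q\,0\}|\}$. Budget sets. $B(\mathbf S)=\{0\}\cup\{m\in\mathcal J:S_m\ge c_m\}$. Let $E_j$ be the set of schools $m$ that use the same placement score as $j$ ($S_m=S_j$) and have $c_m=c_j$ (so $j\in E_j$). Then $B_j^+(\mathbf S)=B(\mathbf S)\cup E_j$ and $B_j^-(\mathbf S)=B(\mathbf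 S)\setminus E_j$. Best options and local preferences. For nonempty $B\subseteq\mathcal J^0$, $Q(B)$ is the most preferred element of $B$ under $Q$; $P(B)$ is the highest-ranked school of $P$ belonging to $B$ if $B\cap P\ne\emptyset$, and $P(B)=0$ otherwise. True local preference: $Q_j=(Q(B_j^+(\mathbf S)),Q(B_j^-(\mathbf S)))$. Reported local preference: $P_j=(P(B_j^+(\mathbf S)),P(B_j^-(\mathbf S)))$. Convention: $\{a\}\times\emptyset=\emptyset$. Sharp means that the support of the conditional distribution of $Q_j$ given $(P,\mathbf S)$ equals $\mathbf Q_j$, i.e. no element of $\mathbf Q_j$ can be ruled out. *)

theory Defs
  imports "HOL-Probability.Probability"
begin

text \<open>
  Schools are the numbers \<open>1..J\<close>, and \<open>0\<close> is the outside option. A preference is a strict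
  relation in which \<open>(d, e) \<in> q\<close> means that \<open>d\<close> is ranked above \<open>e\<close>.
\<close>

definition prefs :: "nat \<Rightarrow> (nat \<times> nat) set set" where
  "prefs J = {q. q \<subseteq> {0..J} \<times> {0..J} \<and> strict_linear_order_on {0..J} q \<and>
                 (\<exists>d\<in>{1..J}. (d, 0) \<in> q)}"

definition lists_upto :: "nat \<Rightarrow> nat \<Rightarrow> nat list set" where
  "lists_upto J K = {p. distinct p \<and> set p \<subseteq> {1..J} \<and> 1 \<le> length p \<and> length p \<le> K}"

abbreviation score_space :: "nat \<Rightarrow> (nat \<Rightarrow> real) measure" where
  "score_space J \<equiv> PiM {1..J} (\<lambda>_. borel)"

definition acceptable :: "(nat \<times> nat) set \<Rightarrow> nat set" where
  "acceptable q = {d. (d, 0) \<in> q}"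

definition listed_above :: "nat list \<Rightarrow> nat \<Rightarrow> nat \<Rightarrow> bool" where
  "listed_above p d e \<longleftrightarrow> (\<exists>i k. i < k \<and> k < length p \<and> p ! i = d \<and> p ! k = e)"

definition weak_partial_order :: "nat \<Rightarrow> nat list \<Rightarrow> (nat \<times> nat) set \<Rightarrow> bool" where
  "weak_partial_order K p q \<longleftrightarrow>
     1 \<le> length p \<and> length p \<le> K \<and> set p \<subseteq> acceptable q \<and>
     (\<forall>d\<in>set p. \<forall>d'\<in>set p. listed_above p d' d \<longleftrightarrow> (d', d) \<in> q)"

definition strong_partial_order :: "nat \<Rightarrow> nat list \<Rightarrow> (nat \<times> nat) set \<Rightarrow> bool" where
  "strong_partial_order K p q \<longleftrightarrow>
     weak_partial_order K p q \<and> length p = min K (card (acceptable q))"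

definition budget :: "nat \<Rightarrow> (nat \<Rightarrow> real) \<Rightarrow> (nat \<Rightarrow> real) \<Rightarrow> nat set" where
  "budget J c s = {0} \<union> {m \<in> {1..J}. c m \<le> s m}"

text \<open>
  Two schools use the same placement score when their scores coincide as random variables, so
  the following set does not depend on the individual student.
\<close>

definition score_class ::
  "'w measure \<Rightarrow> nat \<Rightarrow> (nat \<Rightarrow> real) \<Rightarrow> ('w \<Rightarrow> nat \<Rightarrow> real) \<Rightarrow> nat \<Rightarrow> nat set" where
  "score_class M J c S j = {m \<in> {1..J}. (\<forall>\<omega>\<in>space M. S \<omega> m = S \<omega> j) \<and> c m = c j}"

text \<open>Below, \<open>E\<close> stands for the set \<open>score_class M J c S j\<close>.\<close>

definition budget_plus ::
  "nat \<Rightarrow> (nat \<Rightarrow> real) \<Rightarrow> nat set \<Rightarrow> (nat \<Rightarrow> real) \<Rightarrow> nat set" where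
  "budget_plus J c E s = budget J c s \<union> E"

definition budget_minus ::
  "nat \<Rightarrow> (nat \<Rightarrow> real) \<Rightarrow> nat set \<Rightarrow> (nat \<Rightarrow> real) \<Rightarrow> nat set" where
  "budget_minus J c E s = budget J c s - E"

definition pref_best :: "(nat \<times> nat) set \<Rightarrow> nat set \<Rightarrow> nat" where
  "pref_best q B = (THE d. d \<in> B \<and> (\<forall>e\<in>B - {d}. (d, e) \<in> q))"

text \<open>\<open>List.find\<close> returns the first, that is the highest-ranked, listed school in \<open>B\<close>.\<close>

definition list_best :: "nat list \<Rightarrow> nat set \<Rightarrow> nat" where
  "list_best p B = (case List.find (\<lambda>d. d \<in> B) p of Some d \<Rightarrow> d | None \<Rightarrow> 0)"

definition true_local ::
  "nat \<Rightarrow> (nat \<Rightarrow> real) \<Rightarrow> nat set \<Rightarrow> (nat \<Rightarrow> real) \<Rightarrow> (nat \<times> nat) set \<Rightarrow> nat \<times> nat" where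
  "true_local J c E s q =
     (pref_best q (budget_plus J c E s), pref_best q (budget_minus J c E s))"

definition reported_local ::
  "nat \<Rightarrow> (nat \<Rightarrow> real) \<Rightarrow> nat set \<Rightarrow> (nat \<Rightarrow> real) \<Rightarrow> nat list \<Rightarrow> nat \<times> nat" where
  "reported_local J c E s p =
     (list_best p (budget_plus J c E s), list_best p (budget_minus J c E s))"

definition unlisted :: "nat list \<Rightarrow> nat set \<Rightarrow> nat set" where
  "unlisted p B = B - (set p \<union> {0})"

definition local_set_weak ::
  "nat \<Rightarrow> (nat \<Rightarrow> real) \<Rightarrow> nat set \<Rightarrow> nat \<Rightarrow> (nat \<Rightarrow> real) \<Rightarrow> nat list \<Rightarrow> (nat \<times> nat) set" where
  "local_set_weak J c E j s p =
     (let (a, b) = reported_local J c E s p;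
          Np = unlisted p (budget_plus J c E s);
          Nm = unlisted p (budget_minus J c E s)
      in if c j \<le> s j then
           (if a = b then {(a, b)} else {(a, b)} \<union> ({a} \<times> Nm))
         else {(a, b)} \<union> ((Np - Nm) \<times> {b}))"

text \<open>
  Lists have length at most \<open>K\<close>; when the length equals \<open>K\<close> the three cases are those of
  \<open>local_set_weak\<close>.
\<close>

definition local_set_strong ::
  "nat \<Rightarrow> nat \<Rightarrow> (nat \<Rightarrow> real) \<Rightarrow> nat set \<Rightarrow> nat \<Rightarrow> (nat \<Rightarrow> real) \<Rightarrow> nat list \<Rightarrow> (nat \<times> nat) set" where
  "local_set_strong J K c E j s p =
     (if length p < K then {reported_local J c E s p} else local_set_weak J c E j s p)"

text \<open>
  \<open>\<kappa>\<close> is a version of the conditional distribution of \<open>X\<close> given \<open>Y\<close>, where \<open>Y\<close> takes values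
  in the measurable space \<open>N\<close> and \<open>X\<close> takes countably many values. The support of the
  conditional distribution at \<open>y\<close> is then \<open>set_pmf (\<kappa> y)\<close>.
\<close>

definition cond_pmf_version ::
  "'w measure \<Rightarrow> 'y measure \<Rightarrow> ('w \<Rightarrow> 'y) \<Rightarrow> ('w \<Rightarrow> 'x) \<Rightarrow> ('y \<Rightarrow> 'x pmf) \<Rightarrow> bool" where
  "cond_pmf_version M N Y X \<kappa> \<longleftrightarrow>
     (\<forall>x. (\<lambda>y. pmf (\<kappa> y) x) \<in> borel_measurable N) \<and>
     (\<forall>x. AE \<omega> in M. pmf (\<kappa> (Y \<omega>)) x =
        real_cond_exp M (vimage_algebra (space M) Y N)
          (indicator {\<omega> \<in> space M. X \<omega> = x}) \<omega>)"

end

theory Submission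
  imports Defs
begin

text \<open>
  On any budget set \<open>B\<close> the true and the reported best school can differ only if the true one is
  feasible and unlisted. When \<open>S\<^sub>j \<ge> c\<^sub>j\<close> we have \<open>B\<^sub>j\<^sup>+ = B\<close>, and otherwise \<open>B\<^sub>j\<^sup>- = B\<close>, so the
  cutoff characterizations of \<open>\<mu>\<close> pin down one coordinate of the local preference.
  For sharpness, the reported pair \<open>(a, b)\<close> is realized by a preference whose acceptable schools
  are exactly the list; a pair \<open>(a, y)\<close> is realized by inserting \<open>y\<close> just below \<open>a\<close>, and a pair
  \<open>(x, b)\<close> by putting \<open>x\<close> on top. If \<open>|P| = K\<close> the extra acceptable school is harmless for the strong
  order. Supports are then compared by monotonicity of conditional expectation, which works
  because for a fixed preference the local preference depends only on the budget set.
\<close>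

section \<open>Strict preferences and their best elements\<close>

lemma prefs_trans: "q \<in> prefs J \<Longrightarrow> (d, e) \<in> q \<Longrightarrow> (e, f) \<in> q \<Longrightarrow> (d, f) \<in> q"
  unfolding prefs_def strict_linear_order_on_def by (auto dest: transD)

lemma prefs_irrefl: "q \<in> prefs J \<Longrightarrow> (d, d) \<notin> q"
  unfolding prefs_def strict_linear_order_on_def irrefl_def by auto

lemma prefs_asym: "q \<in> prefs J \<Longrightarrow> (d, e) \<in> q \<Longrightarrow> (e, d) \<notin> q"
  using prefs_trans prefs_irrefl by blast

lemma prefs_total:
  "q \<in> prefs J \<Longrightarrow> d \<in> {0..J} \<Longrightarrow> e \<in> {0..J} \<Longrightarrow> d \<noteq> e \<Longrightarrow> (d, e) \<in> q \<or> (e, d) \<in> q"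
  unfolding prefs_def strict_linear_order_on_def total_on_def by auto

lemma finite_prefs: "finite (prefs J)"
  by (rule finite_subset[of _ "Pow ({0..J} \<times> {0..J})"]) (auto simp: prefs_def)

lemma pref_best_eqI:
  assumes "q \<in> prefs J" "d \<in> B" "\<And>e. e \<in> B \<Longrightarrow> e \<noteq> d \<Longrightarrow> (d, e) \<in> q"
  shows "pref_best q B = d"
  unfolding pref_best_def
proof (rule the_equality)
  fix d' assume d': "d' \<in> B \<and> (\<forall>e\<in>B - {d'}. (d', e) \<in> q)"
  show "d' = d"
  proof (rule ccontr)
    assume "d' \<noteq> d"
    then have "(d', d) \<in> q" "(d, d') \<in> q" using d' assms(2,3) by blast+
    then show False using prefs_asym[OF assms(1)] by blast
  qed
qed (use assms in auto)

lemma pref_best_exists: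
  assumes q: "q \<in> prefs J" and "finite B" "B \<noteq> {}" "B \<subseteq> {0..J}"
  shows "\<exists>d\<in>B. \<forall>e\<in>B. e \<noteq> d \<longrightarrow> (d, e) \<in> q"
  using assms(2-4)
proof (induction B rule: finite_ne_induct)
  case (insert x B)
  then obtain d where d: "d \<in> B" "\<forall>e\<in>B. e \<noteq> d \<longrightarrow> (d, e) \<in> q"
    by auto
  with insert.prems insert.hyps have "(x, d) \<in> q \<or> (d, x) \<in> q"
    by (intro prefs_total[OF q]) auto
  then show ?case
  proof
    assume "(x, d) \<in> q"
    then have "\<forall>e\<in>insert x B. e \<noteq> x \<longrightarrow> (x, e) \<in> q"
      using d(2) prefs_trans[OF q, of x d] by (metis insertE)
    then show ?thesis by blast
  next
    assume "(d, x) \<in> q"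
    then show ?thesis using d by blast
  qed
qed auto

lemma pref_best_props:
  assumes "q \<in> prefs J" "B \<subseteq> {0..J}" "B \<noteq> {}"
  shows "pref_best q B \<in> B" and "\<And>e. e \<in> B \<Longrightarrow> e \<noteq> pref_best q B \<Longrightarrow> (pref_best q B, e) \<in> q"
proof -
  have "finite B" using assms(2) finite_subset by blast
  then obtain d where d: "d \<in> B" "\<forall>e\<in>B. e \<noteq> d \<longrightarrow> (d, e) \<in> q"
    using pref_best_exists[OF assms(1)] assms(2,3) by blast
  then have "pref_best q B = d" by (intro pref_best_eqI[OF assms(1)]) auto
  with d show "pref_best q B \<in> B"
    and "\<And>e. e \<in> B \<Longrightarrow> e \<noteq> pref_best q B \<Longrightarrow> (pref_best q B, e) \<in> q" by auto
qed

text \<open>A best element that survives the passage to a smaller set still beats everything left.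
  This carries the best option of \<open>budget_plus\<close> over to
  \<open>budget_minus\<close>.\<close>

lemma pref_best_subset:
  assumes "q \<in> prefs J" "B \<subseteq> {0..J}" "C \<subseteq> B" "pref_best q B \<in> C"
  shows "pref_best q C = pref_best q B"
  using assms pref_best_props(2)[OF assms(1,2)] by (intro pref_best_eqI[OF assms(1)]) auto

section \<open>First feasible school and ranking along a list\<close>

lemma list_best_Nil [simp]: "list_best [] B = 0"
  by (simp add: list_best_def)

lemma list_best_Cons [simp]: "list_best (x # xs) B = (if x \<in> B then x else list_best xs B)"
  by (simp add: list_best_def)

lemma list_best_append:
  "list_best (xs @ ys) B = (if set xs \<inter> B = {} then list_best ys B else list_best xs B)"
  by (induction xs) auto

lemma list_best_disjoint: "set p \<inter> B = {} \<Longrightarrow> list_best p B = 0"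
  by (induction p) auto

text \<open>Cutting the list at its first member of \<open>B\<close> leaves all other listed members
  of \<open>B\<close> in the tail \<open>ys\<close>.\<close>

lemma list_best_split:
  assumes "set p \<inter> B \<noteq> {}"
  obtains xs ys where "p = xs @ list_best p B # ys" "list_best p B \<in> B" "set xs \<inter> B = {}"
proof -
  obtain xs d ys where "p = xs @ d # ys" "d \<in> B" "\<forall>x\<in>set xs. x \<notin> B"
    using split_list_first_prop[of p "\<lambda>d. d \<in> B"] assms by blast
  moreover from this have "list_best p B = d"
    by (auto simp: list_best_append)
  ultimately show thesis by (intro that[of xs ys]) auto
qed

lemma list_best_mem:
  assumes "set p \<inter> B \<noteq> {}" shows "list_best p B \<in> set p \<inter> B"
proof -
  from assms obtain xs ys where "p = xs @ list_best p B # ys" "list_best p B \<in> B"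
    by (rule list_best_split)
  then show ?thesis by (metis Int_iff in_set_conv_decomp)
qed

lemma list_best_nonzero: "list_best p B \<noteq> 0 \<Longrightarrow> list_best p B \<in> set p \<inter> B"
  using list_best_mem list_best_disjoint by metis

lemma listed_above_Nil [simp]: "\<not> listed_above [] d e"
  by (simp add: listed_above_def)

text \<open>Replaces the indices of the definition by a recursion, so that later facts follow by
  induction and simplification.\<close>

lemma listed_above_Cons [simp]:
  "listed_above (x # xs) d e \<longleftrightarrow> (d = x \<and> e \<in> set xs) \<or> listed_above xs d e" (is "?l \<longleftrightarrow> ?r")
proof
  assume ?l
  then obtain i k where ik: "i < k" "k < length (x # xs)" "(x # xs) ! i = d" "(x # xs) ! k = e"
    unfolding listed_above_def by blast
  from ik obtain k' where k': "k = Suc k'" by (cases k) auto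
  show ?r
  proof (cases i)
    case 0
    with ik k' show ?thesis by auto
  next
    case (Suc i')
    with ik k' show ?thesis unfolding listed_above_def by auto
  qed
next
  assume ?r
  then show ?l
  proof
    assume d: "d = x \<and> e \<in> set xs"
    then obtain k where "k < length xs" "xs ! k = e" by (auto simp: in_set_conv_nth)
    with d show ?l unfolding listed_above_def
      by (intro exI[of _ 0] exI[of _ "Suc k"]) auto
  next
    assume "listed_above xs d e"
    then obtain i k where "i < k" "k < length xs" "xs ! i = d" "xs ! k = e"
      unfolding listed_above_def by blast
    then show ?l unfolding listed_above_def
      by (intro exI[of _ "Suc i"] exI[of _ "Suc k"]) auto
  qed
qed

lemma listed_above_set: "listed_above p d e \<Longrightarrow> d \<in> set p \<and> e \<in> set p"
  by (induction p) auto

lemma listed_above_append [simp]: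
  "listed_above (xs @ ys) d e \<longleftrightarrow>
     listed_above xs d e \<or> listed_above ys d e \<or> (d \<in> set xs \<and> e \<in> set ys)"
  by (induction xs) auto

lemma listed_above_irrefl: "distinct p \<Longrightarrow> \<not> listed_above p d d"
  by (induction p) auto

lemma listed_above_total:
  "d \<in> set p \<Longrightarrow> e \<in> set p \<Longrightarrow> d \<noteq> e \<Longrightarrow> listed_above p d e \<or> listed_above p e d"
  by (induction p) auto

lemma listed_above_trans:
  "distinct p \<Longrightarrow> listed_above p d e \<Longrightarrow> listed_above p e f \<Longrightarrow> listed_above p d f"
  by (induction p) (auto dest: listed_above_set)

text \<open>The witnesses for sharpness are all of this form.\<close>

lemma list_extends_to_pref:
  assumes p: "p \<in> lists_upto J K" and L: "distinct L" "set p \<subseteq> set L" "set L \<subseteq> {1..J}"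
    and order: "\<And>d e. d \<in> set p \<Longrightarrow> e \<in> set p \<Longrightarrow> listed_above L d e \<longleftrightarrow> listed_above p d e"
  obtains q where "q \<in> prefs J" "weak_partial_order K p q" "acceptable q = set L"
    "\<And>B. 0 \<in> B \<Longrightarrow> B \<subseteq> {0..J} \<Longrightarrow> pref_best q B = list_best L B"
proof
  \<comment> \<open>The list \<open>l\<close> enumerates the whole preference: first
    \<open>L\<close>, then the outside option, then all remaining schools. Hence exactly the members
    of \<open>L\<close> are acceptable.\<close>
  define ys where "ys = filter (\<lambda>d. d \<notin> set L) [1..<Suc J]"
  define l where "l = L @ 0 # ys"
  define q where "q = {(d, e). listed_above l d e}"
  have ys: "0 \<notin> set ys" "set ys \<inter> set L = {}" "distinct ys" by (auto simp: ys_def)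
  have zero: "0 \<notin> set L" using L(3) by auto
  have set_l: "set l = {0..J}"
    using L(3) by (auto simp: l_def ys_def)
  have dist: "distinct l" using L(1) ys zero by (auto simp: l_def)
  have p': "set p \<noteq> {}" "1 \<le> length p" "length p \<le> K"
    using p by (auto simp: lists_upto_def)
  show acc: "acceptable q = set L"
    using ys zero by (auto simp: acceptable_def q_def l_def dest: listed_above_set)
  have "trans q"
    using listed_above_trans[OF dist] by (auto simp: q_def intro!: transI)
  moreover have "irrefl q"
    using listed_above_irrefl[OF dist] by (auto simp: q_def irrefl_def)
  moreover have "total_on {0..J} q"
    using listed_above_total[of _ l] set_l by (auto simp: q_def total_on_def)
  moreover have "q \<subseteq> {0..J} \<times> {0..J}"
    using set_l by (auto simp: q_def dest: listed_above_set)
  moreover have "\<exists>d\<in>{1..J}. (d, 0) \<in> q"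
  proof -
    obtain d where "d \<in> set p" using p'(1) by (meson all_not_in_conv)
    then have "d \<in> acceptable q" "d \<in> {1..J}" using acc L(2,3) by blast+
    then show ?thesis by (auto simp: acceptable_def)
  qed
  ultimately show q: "q \<in> prefs J"
    by (simp add: prefs_def strict_linear_order_on_def)
  have "(d', d) \<in> q \<longleftrightarrow> listed_above p d' d" if "d \<in> set p" "d' \<in> set p" for d d'
  proof -
    have "d \<in> set L" "d' \<in> set L" using that L(2) by auto
    then have "(d', d) \<in> q \<longleftrightarrow> listed_above L d' d"
      using ys zero by (auto simp: q_def l_def dest: listed_above_set)
    with order that show ?thesis by simp
  qed
  then show "weak_partial_order K p q"
    using p' acc L(2) by (auto simp: weak_partial_order_def)
  show "pref_best q B = list_best L B" if B: "0 \<in> B" "B \<subseteq> {0..J}" for B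
  proof -
    have "set l \<inter> B \<noteq> {}" using B set_l by auto
    then obtain us vs where l: "l = us @ list_best l B # vs" "list_best l B \<in> B" "set us \<inter> B = {}"
      by (rule list_best_split)
    have "pref_best q B = list_best l B"
    proof (rule pref_best_eqI[OF q l(2)])
      fix e assume e: "e \<in> B" "e \<noteq> list_best l B"
      then have "e \<in> set l" using B(2) set_l by auto
      then have "e \<in> set (us @ list_best l B # vs)" using l(1) by simp
      then have "e \<in> set vs" using e l(3) by auto
      then have "listed_above (us @ list_best l B # vs) (list_best l B) e" by simp
      then show "(list_best l B, e) \<in> q" using l(1) by (simp add: q_def)
    qed
    \<comment> \<open>If \<open>L\<close> misses \<open>B\<close>, the next entry 0 of
      \<open>l\<close> is in \<open>B\<close>, and 0 is also the default value of
      \<open>list_best L B\<close>.\<close>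
    also have "\<dots> = list_best L B"
      using B list_best_disjoint[of L B] by (auto simp: l_def list_best_append)
    finally show ?thesis .
  qed
qed

section \<open>True and reported best options compared\<close>

text \<open>By the weak order, the first listed school in \<open>B\<close> is above 0 and above
  every later listed school, so no other element of \<open>B\<close> that is listed or 0 can be the
  true best.\<close>

lemma pref_best_listed:
  assumes q: "q \<in> prefs J" and wpo: "weak_partial_order K p q"
    and B: "0 \<in> B" "B \<subseteq> {0..J}" and best: "pref_best q B \<in> set p \<union> {0}"
  shows "pref_best q B = list_best p B"
proof (cases "set p \<inter> B = {}")
  case True
  then have "pref_best q B = 0"
    using best pref_best_props(1)[OF q B(2)] B(1) by blast
  then show ?thesis using list_best_disjoint[OF True] by simp
next
  case False
  then obtain xs ys where p: "p = xs @ list_best p B # ys" "list_best p B \<in> B" "set xs \<inter> B = {}"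
    by (rule list_best_split)
  define d m where "d = list_best p B" and "m = pref_best q B"
  note p = p[folded d_def]
  have d: "d \<in> set p" using p(1) by (metis in_set_conv_decomp)
  have m: "m \<in> B" "\<And>e. e \<in> B \<Longrightarrow> e \<noteq> m \<Longrightarrow> (m, e) \<in> q"
    using pref_best_props[OF q B(2)] B(1) unfolding m_def by blast+
  have outside: "(d, 0) \<in> q" using wpo d by (auto simp: weak_partial_order_def acceptable_def)
  have listed: "(d, m) \<in> q" if "m \<in> set p" "m \<noteq> d"
  proof -
    \<comment> \<open>A listed \<open>m\<close> in \<open>B\<close> cannot precede \<open>d\<close>,
      since \<open>xs\<close> misses \<open>B\<close>.\<close>
    have "m \<in> set (xs @ d # ys)" using that(1) p(1) by simp
    then have "m \<in> set ys" using that(2) m(1) p(3) by auto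
    then have "listed_above (xs @ d # ys) d m" by simp
    then have "listed_above p d m" using p(1) by simp
    then show ?thesis using wpo d that(1) by (auto simp: weak_partial_order_def)
  qed
  have "m = d"
  proof (rule ccontr)
    assume "m \<noteq> d"
    then have "(m, d) \<in> q" using m(2) p(2) by simp
    moreover have "m = 0 \<or> m \<in> set p" using best by (auto simp: m_def)
    ultimately have "(d, m) \<in> q \<and> (m, d) \<in> q"
      using \<open>m \<noteq> d\<close> outside listed by auto
    then show False using prefs_asym[OF q, of d m] by simp
  qed
  then show ?thesis by (simp add: m_def d_def)
qed

text \<open>With \<open>length p < K\<close>, the minimum in the strong order must be the number of
  acceptable schools. As entries are distinct, counting turns the inclusion into an
  equality.\<close>

lemma strong_set_eq_acceptable:
  assumes q: "q \<in> prefs J" and "strong_partial_order K p q" "distinct p" "length p < K"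
  shows "set p = acceptable q"
proof (rule card_subset_eq)
  have "acceptable q \<subseteq> {0..J}" using q by (auto simp: acceptable_def prefs_def)
  then show "finite (acceptable q)" using finite_subset by blast
  show "set p \<subseteq> acceptable q" "card (set p) = card (acceptable q)"
    using assms distinct_card[of p]
    by (auto simp: strong_partial_order_def weak_partial_order_def)
qed

lemma pref_best_acceptable:
  assumes "q \<in> prefs J" "0 \<in> B" "B \<subseteq> {0..J}"
  shows "pref_best q B \<in> acceptable q \<union> {0}"
  using pref_best_props(2)[OF assms(1,3), of 0] assms(2)
  by (cases "pref_best q B = 0") (auto simp: acceptable_def)

section \<open>Budget sets and bounds on the true local preference\<close>

lemma budget_bounds: "0 \<in> budget J c s" "budget J c s \<subseteq> {0..J}"
  by (auto simp: budget_def)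

text \<open>The part of \<open>E = score_class M J c S j\<close> that matters for a single score vector.\<close>

definition tied :: "nat \<Rightarrow> (nat \<Rightarrow> real) \<Rightarrow> nat set \<Rightarrow> nat \<Rightarrow> (nat \<Rightarrow> real) \<Rightarrow> bool" where
  "tied J c E j s \<longleftrightarrow> j \<in> E \<and> E \<subseteq> {1..J} \<and> (\<forall>m\<in>E. c m \<le> s m \<longleftrightarrow> c j \<le> s j)"

text \<open>Schools in the class share score and cutoff with \<open>j\<close>, so a student clears
  all of these cutoffs or none.\<close>

lemma tied_score_class:
  assumes "j \<in> {1..J}" "\<omega> \<in> space M"
  shows "tied J c (score_class M J c S j) j (S \<omega>)"
  using assms by (auto simp: tied_def score_class_def)

text \<open>\<open>E\<close> lies inside the budget set if \<open>j\<close> is feasible and is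
  disjoint from it otherwise. The outside option is never removed, as \<open>E\<close> contains only
  schools.\<close>

lemma tied_budget:
  assumes "tied J c E j s"
  shows "0 \<in> budget_plus J c E s" "0 \<in> budget_minus J c E s"
    "budget_plus J c E s \<subseteq> {0..J}" "budget_minus J c E s \<subseteq> {0..J}"
    "c j \<le> s j \<Longrightarrow> budget_plus J c E s = budget J c s"
    "\<not> c j \<le> s j \<Longrightarrow> budget_minus J c E s = budget J c s"
  using assms by (auto simp: tied_def budget_plus_def budget_minus_def budget_def)

text \<open>The cutoff characterization fixes the coordinate whose set is the actual budget set. The
  other true best is as reported or unlisted, and nestedness of the two sets excludes the remaining
  pairs.\<close>

lemma true_local_mem_weak:
  assumes tied: "tied J c E j s" and q: "q \<in> prefs J" and wpo: "weak_partial_order K p q"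
    and match: "pref_best q (budget J c s) = list_best p (budget J c s)"
  shows "true_local J c E s q \<in> local_set_weak J c E j s p"
proof -
  let ?B = "budget J c s" and ?Bp = "budget_plus J c E s" and ?Bm = "budget_minus J c E s"
  note B = tied_budget[OF tied]
  have mp: "?Bm \<subseteq> ?Bp" by (auto simp: budget_plus_def budget_minus_def)
  have unlisted: "pref_best q C = list_best p C \<or> pref_best q C \<in> unlisted p C"
    if "0 \<in> C" "C \<subseteq> {0..J}" for C
    using pref_best_listed[OF q wpo that] pref_best_props(1)[OF q that(2)] that(1)
    unfolding unlisted_def by blast
  show ?thesis
  proof (cases "c j \<le> s j")
    case True
    have plus: "pref_best q ?Bp = list_best p ?Bp" using match B(5)[OF True] by simp
    show ?thesis
    proof (cases "list_best p ?Bp = list_best p ?Bm")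
      case eq: True
      \<comment> \<open>Equal reported schools put the best option of the larger set into the
        smaller one, where it stays best. The default 0 is no exception, since 0 lies in
        \<open>?Bm\<close>.\<close>
      have "list_best p ?Bm \<in> ?Bm"
        using B(2) list_best_nonzero[of p ?Bm] by (cases "list_best p ?Bm = 0") auto
      then have "pref_best q ?Bm = pref_best q ?Bp"
        using pref_best_subset[OF q B(3) mp] plus eq by simp
      then show ?thesis
        using True eq plus by (simp add: local_set_weak_def true_local_def reported_local_def)
    next
      case False
      then show ?thesis
        using True plus unlisted[OF B(2,4)]
        by (auto simp: local_set_weak_def true_local_def reported_local_def Let_def)
    qed
  next
    case False
    have minus: "pref_best q ?Bm = list_best p ?Bm" using match B(6)[OF False] by simp
    \<comment> \<open>The reason for removing \<open>Nm\<close> from \<open>Np\<close>: a school of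
      \<open>?Bm\<close> that is best in \<open>?Bp\<close> is also best in \<open>?Bm\<close>, but
      the best option there is listed or 0.\<close>
    have "pref_best q ?Bp \<notin> unlisted p ?Bm"
    proof
      assume u: "pref_best q ?Bp \<in> unlisted p ?Bm"
      then have "pref_best q ?Bm = pref_best q ?Bp"
        using pref_best_subset[OF q B(3) mp] by (simp add: unlisted_def)
      with u minus have "list_best p ?Bm \<notin> set p \<union> {0}" by (simp add: unlisted_def)
      then show False using list_best_nonzero[of p ?Bm] by auto
    qed
    then show ?thesis
      using False minus unlisted[OF B(1,3)]
      by (auto simp: local_set_weak_def true_local_def reported_local_def Let_def)
  qed
qed

text \<open>A short list contains all acceptable schools, so the best option of any set with 0 in it
  is listed or 0, and both coordinates are as reported. Otherwise the weak bound applies.\<close>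

lemma true_local_mem_strong:
  assumes tied: "tied J c E j s" and q: "q \<in> prefs J" and "strong_partial_order K p q"
    and "distinct p"
    and match: "pref_best q (budget J c s) = list_best p (budget J c s)"
  shows "true_local J c E s q \<in> local_set_strong J K c E j s p"
proof (cases "length p < K")
  case True
  have wpo: "weak_partial_order K p q" using assms(3) by (simp add: strong_partial_order_def)
  have "pref_best q C = list_best p C" if "0 \<in> C" "C \<subseteq> {0..J}" for C
    using pref_best_listed[OF q wpo that] pref_best_acceptable[OF q that]
      strong_set_eq_acceptable[OF q assms(3,4) True] by simp
  then show ?thesis
    using True tied_budget[OF tied]
    by (simp add: local_set_strong_def true_local_def reported_local_def)
next
  case False
  then show ?thesis
    using true_local_mem_weak[OF tied q _ match, of K] assms(3)
    by (simp add: local_set_strong_def strong_partial_order_def)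
qed

section \<open>Preferences that realize each candidate pair\<close>

text \<open>Converse of \<open>true_local_mem_weak\<close>. The last conclusion lets the same
  witness serve the strong order when the list is full.\<close>

lemma local_set_weak_attained:
  assumes tied: "tied J c E j s" and p: "p \<in> lists_upto J K"
    and x: "x \<in> local_set_weak J c E j s p"
  obtains q where "q \<in> prefs J" "weak_partial_order K p q"
    "pref_best q (budget J c s) = list_best p (budget J c s)"
    "true_local J c E s q = x"
    "length p = K \<Longrightarrow> strong_partial_order K p q"
proof -
  note witness = that
  let ?B = "budget J c s" and ?Bp = "budget_plus J c E s" and ?Bm = "budget_minus J c E s"
  note B = tied_budget[OF tied]
  have p': "distinct p" "set p \<subseteq> {1..J}" using p by (auto simp: lists_upto_def)
  have attained: thesis
    if L: "distinct L" "set p \<subseteq> set L" "set L \<subseteq> {1..J}"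
      and order: "\<And>d e. d \<in> set p \<Longrightarrow> e \<in> set p \<Longrightarrow> listed_above L d e \<longleftrightarrow> listed_above p d e"
      and match: "list_best L ?B = list_best p ?B"
      and xL: "x = (list_best L ?Bp, list_best L ?Bm)" for L
  proof -
    obtain q where q: "q \<in> prefs J" "weak_partial_order K p q" "acceptable q = set L"
      "\<And>C. 0 \<in> C \<Longrightarrow> C \<subseteq> {0..J} \<Longrightarrow> pref_best q C = list_best L C"
      using list_extends_to_pref[OF p L order] by blast
    \<comment> \<open>For a full list, at least \<open>K\<close> schools are then acceptable, so the
      minimum in the strong order is \<open>K\<close>.\<close>
    have "length p \<le> card (set L)"
      using card_mono[OF _ L(2)] distinct_card[OF p'(1)] by simp
    then have "strong_partial_order K p q" if "length p = K"
      using q(2,3) that by (simp add: strong_partial_order_def)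
    moreover have "pref_best q ?B = list_best p ?B"
      using q(4) budget_bounds match by simp
    moreover have "true_local J c E s q = x"
      using q(4) B xL by (simp add: true_local_def)
    ultimately show thesis using q(1,2) by (intro witness)
  qed
  consider (reported) "x = (list_best p ?Bp, list_best p ?Bm)"
    | (minus) y where "c j \<le> s j" "list_best p ?Bp \<noteq> list_best p ?Bm"
        "x = (list_best p ?Bp, y)" "y \<in> unlisted p ?Bm"
    | (plus) y where "\<not> c j \<le> s j" "x = (y, list_best p ?Bm)" "y \<in> unlisted p ?Bp - unlisted p ?Bm"
    using x by (auto simp: local_set_weak_def reported_local_def Let_def split: if_splits)
  then show thesis
  proof cases
    case reported
    then show thesis using attained[of p] p' by auto
  next
    case minus
    let ?a = "list_best p ?Bp"
    have mp: "?Bm \<subseteq> ?Bp" by (auto simp: budget_plus_def budget_minus_def)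
    \<comment> \<open>A list missing \<open>?Bp\<close> would miss \<open>?Bm\<close> too, and both
      reported schools would be the default 0.\<close>
    have "set p \<inter> ?Bp \<noteq> {}"
    proof
      assume "set p \<inter> ?Bp = {}"
      then have "set p \<inter> ?Bm = {}" using mp by blast
      with \<open>set p \<inter> ?Bp = {}\<close> minus(2) show False by (simp add: list_best_disjoint)
    qed
    then obtain us vs where split: "p = us @ ?a # vs" "?a \<in> ?Bp" "set us \<inter> ?Bp = {}"
      by (rule list_best_split)
    obtain a where a: "a = ?a" by simp
    note split = split[folded a]
    have us: "set us \<inter> ?Bm = {}" using split(3) mp by blast
    \<comment> \<open>Otherwise \<open>a\<close> would be the first listed school in
      \<open>?Bm\<close> as well, against the inequality of the reported schools.\<close>
    have "a \<notin> ?Bm"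
    proof
      assume "a \<in> ?Bm"
      then have "list_best p ?Bm = a"
        unfolding split(1) using us by (simp add: list_best_append)
      then show False using minus(2) a by simp
    qed
    have y: "y \<notin> set p" "y \<noteq> 0" "y \<in> ?Bm" using minus(4) by (auto simp: unlisted_def)
    then have y': "y \<notin> set us" "y \<noteq> a" "y \<notin> set vs" "y \<in> {1..J}"
      using split(1) B(4) by auto
    \<comment> \<open>On \<open>?Bp\<close>, here the budget set, \<open>a\<close> precedes
      \<open>y\<close> and nothing changes. On \<open>?Bm\<close>, \<open>us\<close> and
      \<open>a\<close> drop out, so \<open>y\<close> comes first.\<close>
    show thesis
    proof (rule attained[of "us @ a # y # vs"])
      show "distinct (us @ a # y # vs)" "set p \<subseteq> set (us @ a # y # vs)"
        "set (us @ a # y # vs) \<subseteq> {1..J}"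
        using p' split(1) y' by auto
      show "listed_above (us @ a # y # vs) d e \<longleftrightarrow> listed_above p d e"
        if "d \<in> set p" "e \<in> set p" for d e
        using that y(1) unfolding split(1) by auto
      show "list_best (us @ a # y # vs) ?B = list_best p ?B"
        unfolding split(1) using split(2,3) by (simp add: list_best_append B(5)[OF minus(1)])
      show "x = (list_best (us @ a # y # vs) ?Bp, list_best (us @ a # y # vs) ?Bm)"
        unfolding minus(3) a[symmetric] using split(2,3) us \<open>a \<notin> ?Bm\<close> y(3)
        by (simp add: list_best_append)
    qed
  next
    case plus
    have y: "y \<in> ?Bp" "y \<notin> ?Bm" "y \<notin> set p" "y \<in> {1..J}"
      using plus(3) B(3) by (auto simp: unlisted_def)
    \<comment> \<open>The new top entry \<open>y\<close> is chosen from \<open>?Bp\<close> but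
      skipped in \<open>?Bm\<close>, here the budget set.\<close>
    show thesis
    proof (rule attained[of "y # p"])
      show "listed_above (y # p) d e \<longleftrightarrow> listed_above p d e" if "d \<in> set p" "e \<in> set p" for d e
        using that y(3) by auto
      show "list_best (y # p) ?B = list_best p ?B"
        using y(2) B(6)[OF plus(1)] by simp
    qed (use p' y plus(2) in auto)
  qed
qed

text \<open>Below full length an extra acceptable school would break the strong order; the reported
  pair is then the only candidate and \<open>q0\<close> attains it. At full length the weak
  witnesses are strong already.\<close>

lemma local_set_strong_attained:
  assumes tied: "tied J c E j s" and p: "p \<in> lists_upto J K"
    and q0: "q0 \<in> prefs J" "strong_partial_order K p q0"
      "pref_best q0 (budget J c s) = list_best p (budget J c s)"
    and x: "x \<in> local_set_strong J K c E j s p"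
  obtains q where "q \<in> prefs J" "strong_partial_order K p q"
    "pref_best q (budget J c s) = list_best p (budget J c s)"
    "true_local J c E s q = x"
proof (cases "length p < K")
  case True
  have "distinct p" using p by (simp add: lists_upto_def)
  then have "true_local J c E s q0 = x"
    using true_local_mem_strong[OF tied q0(1,2) _ q0(3)] x True
    by (simp add: local_set_strong_def)
  then show thesis using that q0 by blast
next
  case False
  then have "length p = K" "x \<in> local_set_weak J c E j s p"
    using p x by (auto simp: lists_upto_def local_set_strong_def)
  then show thesis using local_set_weak_attained[OF tied p] that by metis
qed

section \<open>Measurability through the budget set\<close>

text \<open>The condition sees the scores only through the budget set, which has finitely many
  values, so the set is a preimage from a countable discrete space.\<close>

lemma countable_sets_budget:
  assumes "countable C"
    and cong: "\<And>p s s'. budget J c s = budget J c s' \<Longrightarrow> \<Psi> p s \<longleftrightarrow> \<Psi> p s'"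
  shows "{y \<in> space (count_space C \<Otimes>\<^sub>M score_space J). \<Psi> (fst y) (snd y)}
    \<in> sets (count_space C \<Otimes>\<^sub>M score_space J)"
proof -
  have [measurable]: "budget J c \<in> score_space J \<rightarrow>\<^sub>M count_space (Pow {0..J})"
  proof (subst measurable_count_space_eq2, simp, intro conjI ballI)
    show "budget J c \<in> space (score_space J) \<rightarrow> Pow {0..J}" by (auto simp: budget_def)
    fix A :: "nat set"
    have "budget J c -` {A} \<inter> space (score_space J) =
      {s \<in> space (score_space J). \<forall>m. m \<in> A \<longleftrightarrow> m = 0 \<or> m \<in> {1..J} \<and> c m \<le> s m}"
    proof -
      have mem: "m \<in> budget J c s \<longleftrightarrow> m = 0 \<or> m \<in> {1..J} \<and> c m \<le> s m" for m s
        by (auto simp: budget_def)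
      have eq: "A = budget J c s \<longleftrightarrow> (\<forall>m. m \<in> A \<longleftrightarrow> m = 0 \<or> m \<in> {1..J} \<and> c m \<le> s m)" for s
        by (simp only: set_eq_iff mem)
      show ?thesis unfolding eq[symmetric] by blast
    qed
    also have "\<dots> \<in> sets (score_space J)"
    proof (rule sets.sets_Collect_countable_All)
      fix m
      show "{s \<in> space (score_space J). m \<in> A \<longleftrightarrow> m = 0 \<or> m \<in> {1..J} \<and> c m \<le> s m}
          \<in> sets (score_space J)"
      proof (cases "m \<in> {1..J}")
        case True
        then have [measurable]: "(\<lambda>s. s m) \<in> borel_measurable (score_space J)"
          by (rule measurable_component_singleton)
        show ?thesis by measurable
      next
        case False
        \<comment> \<open>Outside \<open>{1..J}\<close> there is no score to measure, and the
          condition does not depend on \<open>s\<close>.\<close>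
        then have "{s \<in> space (score_space J). m \<in> A \<longleftrightarrow> m = 0 \<or> m \<in> {1..J} \<and> c m \<le> s m} =
            {s \<in> space (score_space J). m \<in> A \<longleftrightarrow> m = 0}"
          by blast
        then show ?thesis by simp
      qed
    qed
    finally show "budget J c -` {A} \<inter> space (score_space J) \<in> sets (score_space J)" .
  qed
  have "(\<lambda>y. (fst y, budget J c (snd y))) \<in>
      count_space C \<Otimes>\<^sub>M score_space J \<rightarrow>\<^sub>M count_space (C \<times> Pow {0..J})"
  proof -
    have "count_space C \<Otimes>\<^sub>M count_space (Pow {0..J}) = count_space (C \<times> Pow {0..J})"
      by (rule pair_measure_countable) (auto intro: assms(1) countable_finite)
    moreover have "(\<lambda>y. (fst y, budget J c (snd y))) \<in>
        count_space C \<Otimes>\<^sub>M score_space J \<rightarrow>\<^sub>M count_space C \<Otimes>\<^sub>M count_space (Pow {0..J})"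
      by measurable
    ultimately show ?thesis by simp
  qed
  then have "(\<lambda>y. (fst y, budget J c (snd y))) -` {(p, budget J c s) | p s. p \<in> C \<and> \<Psi> p s} \<inter>
      space (count_space C \<Otimes>\<^sub>M score_space J) \<in> sets (count_space C \<Otimes>\<^sub>M score_space J)"
    by (rule measurable_sets) (use budget_bounds(2) in auto)
  also have "(\<lambda>y. (fst y, budget J c (snd y))) -` {(p, budget J c s) | p s. p \<in> C \<and> \<Psi> p s} \<inter>
      space (count_space C \<Otimes>\<^sub>M score_space J) =
      {y \<in> space (count_space C \<Otimes>\<^sub>M score_space J). \<Psi> (fst y) (snd y)}"
  proof (intro set_eqI iffI)
    fix y assume "y \<in> (\<lambda>y. (fst y, budget J c (snd y))) -` {(p, budget J c s) | p s. p \<in> C \<and> \<Psi> p s} \<inter>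
      space (count_space C \<Otimes>\<^sub>M score_space J)"
    then obtain s where "budget J c (snd y) = budget J c s" "\<Psi> (fst y) s"
      and y: "y \<in> space (count_space C \<Otimes>\<^sub>M score_space J)" by auto
    \<comment> \<open>By \<open>cong\<close>, replacing the scores by another vector with the same
      budget set loses nothing.\<close>
    then have "\<Psi> (fst y) (snd y)" using cong by blast
    with y show "y \<in> {y \<in> space (count_space C \<Otimes>\<^sub>M score_space J). \<Psi> (fst y) (snd y)}"
      by simp
  next
    fix y assume "y \<in> {y \<in> space (count_space C \<Otimes>\<^sub>M score_space J). \<Psi> (fst y) (snd y)}"
    then show "y \<in> (\<lambda>y. (fst y, budget J c (snd y))) -` {(p, budget J c s) | p s. p \<in> C \<and> \<Psi> p s} \<inter>
      space (count_space C \<Otimes>\<^sub>M score_space J)"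
      by (auto simp: space_pair_measure)
  qed
  finally show ?thesis .
qed

section \<open>Supports of conditional distributions\<close>

text \<open>\<open>U\<close> is contained in \<open>V\<close> only where
  \<open>Y \<omega> \<in> A\<close>. This event belongs to the conditioning sigma-algebra, so its
  indicator can be taken out of the conditional expectation before monotonicity is applied.\<close>

lemma (in prob_space) real_cond_exp_indicator_mono:
  assumes Y: "Y \<in> M \<rightarrow>\<^sub>M N" and A: "A \<in> sets N" and [measurable]: "U \<in> sets M" "V \<in> sets M"
    and sub: "\<And>\<omega>. \<omega> \<in> U \<Longrightarrow> Y \<omega> \<in> A \<Longrightarrow> \<omega> \<in> V"
  shows "AE \<omega> in M. Y \<omega> \<in> A \<longrightarrow>
    real_cond_exp M (vimage_algebra (space M) Y N) (indicator U) \<omega> \<le>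
    real_cond_exp M (vimage_algebra (space M) Y N) (indicator V) \<omega>"
proof -
  let ?F = "vimage_algebra (space M) Y N"
  have F: "subalgebra M ?F"
    using Y by (auto simp: subalgebra_def sets_vimage_algebra2 measurable_def)
  interpret finite_measure_subalgebra M ?F
    using F by unfold_locales
  define A' where "A' = Y -` A \<inter> space M"
  have A'F [measurable]: "A' \<in> sets ?F"
    unfolding A'_def using A by (rule in_vimage_algebra)
  have A'M [measurable]: "A' \<in> sets M" using A'F F by (auto simp: subalgebra_def)
  have int: "integrable M (\<lambda>\<omega>. indicator A' \<omega> * indicator U \<omega> :: real)"
    by (simp add: indicator_inter_arith[symmetric] emeasure_eq_measure)
  have "AE \<omega> in M. real_cond_exp M ?F (\<lambda>\<omega>. indicator A' \<omega> * indicator U \<omega>) \<omega> =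
      indicator A' \<omega> * real_cond_exp M ?F (indicator U) \<omega>"
    by (rule real_cond_exp_mult) (use int in auto)
  moreover have "AE \<omega> in M. real_cond_exp M ?F (\<lambda>\<omega>. indicator A' \<omega> * indicator U \<omega>) \<omega> \<le>
      real_cond_exp M ?F (indicator V) \<omega>"
  proof (rule real_cond_exp_mono)
    show "AE \<omega> in M. indicator A' \<omega> * indicator U \<omega> \<le> (indicator V \<omega> :: real)"
      using sub by (auto simp: A'_def indicator_def)
  qed (use int in \<open>auto simp: emeasure_eq_measure\<close>)
  moreover have "AE \<omega> in M. \<omega> \<in> space M" by simp
  ultimately show ?thesis
    by eventually_elim (auto simp: A'_def indicator_def)
qed

text \<open>Where \<open>Y\<close> lies in \<open>A\<close>, the conditional mass of
  \<open>Z\<close> at \<open>z\<close> is at least that of \<open>X\<close> at \<open>x\<close>, so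
  positivity is passed on.\<close>

lemma (in prob_space) cond_pmf_version_image_support:
  assumes Y: "Y \<in> M \<rightarrow>\<^sub>M N" and A: "A \<in> sets N"
    and sets: "{\<omega> \<in> space M. X \<omega> = x} \<in> sets M" "{\<omega> \<in> space M. Z \<omega> = z} \<in> sets M"
    and \<kappa>: "cond_pmf_version M N Y X \<kappa>" "cond_pmf_version M N Y Z \<kappa>'"
    and sub: "\<And>\<omega>. \<omega> \<in> space M \<Longrightarrow> Y \<omega> \<in> A \<Longrightarrow> X \<omega> = x \<Longrightarrow> Z \<omega> = z"
  shows "AE \<omega> in M. Y \<omega> \<in> A \<longrightarrow> x \<in> set_pmf (\<kappa> (Y \<omega>)) \<longrightarrow> z \<in> set_pmf (\<kappa>' (Y \<omega>))"
proof -
  have "AE \<omega> in M. Y \<omega> \<in> A \<longrightarrow>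
    real_cond_exp M (vimage_algebra (space M) Y N) (indicator {\<omega> \<in> space M. X \<omega> = x}) \<omega> \<le>
    real_cond_exp M (vimage_algebra (space M) Y N) (indicator {\<omega> \<in> space M. Z \<omega> = z}) \<omega>"
    by (rule real_cond_exp_indicator_mono[OF Y A sets]) (use sub in auto)
  moreover have "AE \<omega> in M. pmf (\<kappa> (Y \<omega>)) x =
    real_cond_exp M (vimage_algebra (space M) Y N) (indicator {\<omega> \<in> space M. X \<omega> = x}) \<omega>"
    "AE \<omega> in M. pmf (\<kappa>' (Y \<omega>)) z =
    real_cond_exp M (vimage_algebra (space M) Y N) (indicator {\<omega> \<in> space M. Z \<omega> = z}) \<omega>"
    using \<kappa> unfolding cond_pmf_version_def by blast+
  ultimately show ?thesis
  proof eventually_elim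
    case (elim \<omega>)
    show ?case
    proof (intro impI)
      assume "Y \<omega> \<in> A" "x \<in> set_pmf (\<kappa> (Y \<omega>))"
      then have "0 < pmf (\<kappa>' (Y \<omega>)) z"
        using elim pmf_positive[of x "\<kappa> (Y \<omega>)"] by linarith
      then show "z \<in> set_pmf (\<kappa>' (Y \<omega>))" by (simp add: set_pmf_iff)
    qed
  qed
qed

text \<open>Comparison with the empty event, whose conditional expectation vanishes, leaves no mass
  at \<open>z\<close>.\<close>

lemma (in prob_space) cond_pmf_version_support_avoids:
  assumes Y: "Y \<in> M \<rightarrow>\<^sub>M N" and A: "A \<in> sets N"
    and sets: "{\<omega> \<in> space M. Z \<omega> = z} \<in> sets M"
    and \<kappa>: "cond_pmf_version M N Y Z \<kappa>"
    and avoid: "\<And>\<omega>. \<omega> \<in> space M \<Longrightarrow> Y \<omega> \<in> A \<Longrightarrow> Z \<omega> \<noteq> z"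
  shows "AE \<omega> in M. Y \<omega> \<in> A \<longrightarrow> z \<notin> set_pmf (\<kappa> (Y \<omega>))"
proof -
  let ?F = "vimage_algebra (space M) Y N"
  interpret finite_measure_subalgebra M ?F
    by unfold_locales (use Y in \<open>auto simp: subalgebra_def sets_vimage_algebra2 measurable_def\<close>)
  have "AE \<omega> in M. Y \<omega> \<in> A \<longrightarrow>
    real_cond_exp M ?F (indicator {\<omega> \<in> space M. Z \<omega> = z}) \<omega> \<le> real_cond_exp M ?F (indicator {}) \<omega>"
    by (rule real_cond_exp_indicator_mono[OF Y A sets]) (use avoid in auto)
  moreover have "AE \<omega> in M. real_cond_exp M ?F (indicator {}) \<omega> = indicator {} \<omega>"
    by (rule real_cond_exp_F_meas) auto
  moreover have "AE \<omega> in M. pmf (\<kappa> (Y \<omega>)) z =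
    real_cond_exp M ?F (indicator {\<omega> \<in> space M. Z \<omega> = z}) \<omega>"
    using \<kappa> unfolding cond_pmf_version_def by blast
  ultimately show ?thesis
  proof eventually_elim
    case (elim \<omega>)
    show ?case
    proof (intro impI notI)
      assume "Y \<omega> \<in> A" "z \<in> set_pmf (\<kappa> (Y \<omega>))"
      then show False
        using elim pmf_positive[of z "\<kappa> (Y \<omega>)"] by simp
    qed
  qed
qed

section \<open>From membership and attainment to sharpness\<close>

text \<open>\<open>L\<close> and \<open>W\<close> stand for the candidate set and the partial-order
  condition, so the weak and the strong case are both instances. Soundness bounds the support from
  above; attainment with full support bounds it from below.\<close>

lemma sharp_support:
  fixes L :: "(nat \<Rightarrow> real) \<Rightarrow> nat list \<Rightarrow> (nat \<times> nat) set"
  assumes "prob_space M"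
    and Q: "Q \<in> M \<rightarrow>\<^sub>M count_space (prefs J)"
    and P: "P \<in> M \<rightarrow>\<^sub>M count_space (lists_upto J K)"
    and S: "S \<in> M \<rightarrow>\<^sub>M score_space J"
    and \<kappa>: "cond_pmf_version M (count_space (lists_upto J K) \<Otimes>\<^sub>M score_space J)
        (\<lambda>\<omega>. (P \<omega>, S \<omega>)) Q \<kappa>"
      "cond_pmf_version M (count_space (lists_upto J K) \<Otimes>\<^sub>M score_space J)
        (\<lambda>\<omega>. (P \<omega>, S \<omega>)) (\<lambda>\<omega>. true_local J c E (S \<omega>) (Q \<omega>)) \<kappa>\<^sub>j"
    and L_cong: "\<And>p s s'. budget J c s = budget J c s' \<Longrightarrow> L s p = L s' p"
    and sound: "\<And>\<omega>. \<omega> \<in> space M \<Longrightarrow> true_local J c E (S \<omega>) (Q \<omega>) \<in> L (S \<omega>) (P \<omega>)"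
    and attained: "\<And>\<omega> x. \<omega> \<in> space M \<Longrightarrow> x \<in> L (S \<omega>) (P \<omega>) \<Longrightarrow>
      \<exists>q\<in>prefs J. W (P \<omega>) q \<and>
        pref_best q (budget J c (S \<omega>)) = list_best (P \<omega>) (budget J c (S \<omega>)) \<and>
        true_local J c E (S \<omega>) q = x"
  shows "AE \<omega> in M.
    {q \<in> prefs J. W (P \<omega>) q \<and>
       pref_best q (budget J c (S \<omega>)) = list_best (P \<omega>) (budget J c (S \<omega>))}
      \<subseteq> set_pmf (\<kappa> (P \<omega>, S \<omega>)) \<longrightarrow>
    set_pmf (\<kappa>\<^sub>j (P \<omega>, S \<omega>)) = L (S \<omega>) (P \<omega>)"
proof -
  interpret prob_space M by fact
  define N where "N = count_space (lists_upto J K) \<Otimes>\<^sub>M score_space J"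
  define Y where "Y = (\<lambda>\<omega>. (P \<omega>, S \<omega>))"
  define tl where "tl = true_local J c E"
  have Y: "Y \<in> M \<rightarrow>\<^sub>M N"
    unfolding Y_def N_def using P S by measurable
  have tl_cong: "tl s = tl s'" if "budget J c s = budget J c s'" for s s'
    using that by (auto simp: tl_def true_local_def budget_plus_def budget_minus_def)
  have sets_tl: "{\<omega> \<in> space M. tl (S \<omega>) (Q \<omega>) = x} \<in> sets M" for x
  proof -
    have QS: "(\<lambda>\<omega>. (Q \<omega>, S \<omega>)) \<in> M \<rightarrow>\<^sub>M count_space (prefs J) \<Otimes>\<^sub>M score_space J"
      using Q S by measurable
    let ?A = "{y \<in> space (count_space (prefs J) \<Otimes>\<^sub>M score_space J). tl (snd y) (fst y) = x}"
    \<comment> \<open>Here preferences take the place of lists in the discrete factor.\<close>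
    have "?A \<in> sets (count_space (prefs J) \<Otimes>\<^sub>M score_space J)"
    proof (rule countable_sets_budget[of _ _ c "\<lambda>q s. tl s q = x"])
      show "tl s q = x \<longleftrightarrow> tl s' q = x" if "budget J c s = budget J c s'" for q s s'
        using tl_cong[OF that] by simp
    qed (rule countable_finite[OF finite_prefs])
    then have "(\<lambda>\<omega>. (Q \<omega>, S \<omega>)) -` ?A \<inter> space M \<in> sets M"
      by (rule measurable_sets[OF QS])
    also have "(\<lambda>\<omega>. (Q \<omega>, S \<omega>)) -` ?A \<inter> space M = {\<omega> \<in> space M. tl (S \<omega>) (Q \<omega>) = x}"
      by (auto dest: measurable_space[OF QS])
    finally show ?thesis .
  qed
  have sets_Q: "{\<omega> \<in> space M. Q \<omega> = q} \<in> sets M" if "q \<in> prefs J" for q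
    using measurable_sets[OF Q, of "{q}"] that by (simp add: vimage_def Int_def conj_commute)
  \<comment> \<open>Finitely many \<open>q\<close> and countably many pairs \<open>x\<close> occur,
    so one null set serves them all.\<close>
  have lower: "AE \<omega> in M. \<forall>q\<in>prefs J. \<forall>x. tl (S \<omega>) q = x \<longrightarrow>
      q \<in> set_pmf (\<kappa> (Y \<omega>)) \<longrightarrow> x \<in> set_pmf (\<kappa>\<^sub>j (Y \<omega>))"
  proof (intro AE_finite_allI finite_prefs, subst AE_all_countable, intro allI)
    fix q x assume q: "q \<in> prefs J"
    \<comment> \<open>Where \<open>(P \<omega>, S \<omega>)\<close> lies in \<open>?A\<close>, the
      event \<open>Q \<omega> = q\<close> forces the true local preference to be
      \<open>x\<close>.\<close>
    let ?A = "{y \<in> space N. tl (snd y) q = x}"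
    have A: "?A \<in> sets N"
      unfolding N_def
    proof (rule countable_sets_budget[of _ _ c "\<lambda>p s. tl s q = x"])
      show "tl s q = x \<longleftrightarrow> tl s' q = x" if "budget J c s = budget J c s'" for s s'
        using tl_cong[OF that] by simp
    qed simp
    have "AE \<omega> in M. Y \<omega> \<in> ?A \<longrightarrow> q \<in> set_pmf (\<kappa> (Y \<omega>)) \<longrightarrow> x \<in> set_pmf (\<kappa>\<^sub>j (Y \<omega>))"
      by (rule cond_pmf_version_image_support[OF Y A sets_Q[OF q] sets_tl[of x]])
        (use \<kappa> in \<open>auto simp: Y_def N_def tl_def\<close>)
    then show "AE \<omega> in M. tl (S \<omega>) q = x \<longrightarrow> q \<in> set_pmf (\<kappa> (Y \<omega>)) \<longrightarrow> x \<in> set_pmf (\<kappa>\<^sub>j (Y \<omega>))"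
      using AE_space
    proof eventually_elim
      case (elim \<omega>)
      then show ?case using measurable_space[OF Y, of \<omega>] by (auto simp: Y_def)
    qed
  qed
  \<comment> \<open>For each of the countably many \<open>x\<close>, soundness forbids this value
    wherever \<open>x\<close> is not a candidate.\<close>
  have upper: "AE \<omega> in M. \<forall>x. x \<notin> L (S \<omega>) (P \<omega>) \<longrightarrow> x \<notin> set_pmf (\<kappa>\<^sub>j (Y \<omega>))"
  proof (subst AE_all_countable, intro allI)
    fix x
    let ?A = "{y \<in> space N. x \<notin> L (snd y) (fst y)}"
    have A: "?A \<in> sets N"
      unfolding N_def
    proof (rule countable_sets_budget[of _ _ c "\<lambda>p s. x \<notin> L s p"])
      show "x \<notin> L s p \<longleftrightarrow> x \<notin> L s' p" if "budget J c s = budget J c s'" for p s s'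
        using L_cong[OF that] by simp
    qed simp
    have "AE \<omega> in M. Y \<omega> \<in> ?A \<longrightarrow> x \<notin> set_pmf (\<kappa>\<^sub>j (Y \<omega>))"
      by (rule cond_pmf_version_support_avoids[OF Y A sets_tl[of x]])
        (use \<kappa> sound in \<open>auto simp: Y_def N_def tl_def\<close>)
    then show "AE \<omega> in M. x \<notin> L (S \<omega>) (P \<omega>) \<longrightarrow> x \<notin> set_pmf (\<kappa>\<^sub>j (Y \<omega>))"
      using AE_space
    proof eventually_elim
      case (elim \<omega>)
      then show ?case using measurable_space[OF Y, of \<omega>] by (auto simp: Y_def)
    qed
  qed
  from lower upper AE_space show ?thesis
  proof eventually_elim
    case (elim \<omega>)
    show ?case
    proof (intro impI subset_antisym subsetI)
      fix x assume "x \<in> set_pmf (\<kappa>\<^sub>j (P \<omega>, S \<omega>))"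
      then show "x \<in> L (S \<omega>) (P \<omega>)" using elim(2) unfolding Y_def by blast
    next
      fix x assume "{q \<in> prefs J. W (P \<omega>) q \<and>
          pref_best q (budget J c (S \<omega>)) = list_best (P \<omega>) (budget J c (S \<omega>))}
          \<subseteq> set_pmf (\<kappa> (P \<omega>, S \<omega>))"
        and "x \<in> L (S \<omega>) (P \<omega>)"
      \<comment> \<open>Full support enters here: the attaining preference is compatible with the
        data and hence in the support of \<open>\<kappa>\<close>.\<close>
      then obtain q where "q \<in> prefs J" "q \<in> set_pmf (\<kappa> (P \<omega>, S \<omega>))" "tl (S \<omega>) q = x"
        using attained[OF elim(3)] unfolding tl_def by blast
      then show "x \<in> set_pmf (\<kappa>\<^sub>j (P \<omega>, S \<omega>))" using elim(1) unfolding Y_def by blast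
    qed
  qed
qed

text \<open>As \<open>j\<close> is a school, the test \<open>c j \<le> s j\<close> amounts to
  membership of \<open>j\<close> in the budget set.\<close>

lemma local_set_weak_cong:
  assumes "j \<in> {1..J}" "budget J c s = budget J c s'"
  shows "local_set_weak J c E j s p = local_set_weak J c E j s' p"
proof -
  have "c j \<le> s j \<longleftrightarrow> j \<in> budget J c s" "c j \<le> s' j \<longleftrightarrow> j \<in> budget J c s'"
    using assms(1) by (auto simp: budget_def)
  then have "c j \<le> s j \<longleftrightarrow> c j \<le> s' j" using assms(2) by simp
  then show ?thesis
    using assms(2)
    by (simp add: local_set_weak_def reported_local_def budget_plus_def budget_minus_def)
qed

lemma local_set_strong_cong:
  assumes "j \<in> {1..J}" "budget J c s = budget J c s'"
  shows "local_set_strong J K c E j s p = local_set_strong J K c E j s' p"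
  using local_set_weak_cong[OF assms] assms(2)
  by (simp add: local_set_strong_def reported_local_def budget_plus_def budget_minus_def)

theorem proposition2:
  fixes M :: "'w measure" and J K j :: nat and c :: "nat \<Rightarrow> real" and E :: "nat set"
    and Q :: "'w \<Rightarrow> (nat \<times> nat) set" and P :: "'w \<Rightarrow> nat list"
    and S :: "'w \<Rightarrow> nat \<Rightarrow> real" and \<mu> :: "'w \<Rightarrow> nat"
  assumes "prob_space M" and "K < J" and "j \<in> {1..J}"
    and "Q \<in> M \<rightarrow>\<^sub>M count_space (prefs J)"
    and "P \<in> M \<rightarrow>\<^sub>M count_space (lists_upto J K)"
    and "S \<in> M \<rightarrow>\<^sub>M score_space J"
    and weak: "\<forall>\<omega>\<in>space M. weak_partial_order K (P \<omega>) (Q \<omega>)"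
    and match_true: "\<forall>\<omega>\<in>space M. \<mu> \<omega> = pref_best (Q \<omega>) (budget J c (S \<omega>))"
    and match_reported: "\<forall>\<omega>\<in>space M. \<mu> \<omega> = list_best (P \<omega>) (budget J c (S \<omega>))"
    and E: "E = score_class M J c S j"
  shows
    "(\<forall>\<omega>\<in>space M. true_local J c E (S \<omega>) (Q \<omega>) \<in> local_set_weak J c E j (S \<omega>) (P \<omega>)) \<and>
     (\<forall>\<omega>\<in>space M. strong_partial_order K (P \<omega>) (Q \<omega>) \<longrightarrow>
        true_local J c E (S \<omega>) (Q \<omega>) \<in> local_set_strong J K c E j (S \<omega>) (P \<omega>)) \<and>
     (\<forall>\<kappa> \<kappa>\<^sub>j.
        cond_pmf_version M (count_space (lists_upto J K) \<Otimes>\<^sub>M score_space J)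
          (\<lambda>\<omega>. (P \<omega>, S \<omega>)) Q \<kappa> \<and>
        cond_pmf_version M (count_space (lists_upto J K) \<Otimes>\<^sub>M score_space J)
          (\<lambda>\<omega>. (P \<omega>, S \<omega>)) (\<lambda>\<omega>. true_local J c E (S \<omega>) (Q \<omega>)) \<kappa>\<^sub>j \<longrightarrow>
        (AE \<omega> in M.
           {q \<in> prefs J. weak_partial_order K (P \<omega>) q \<and>
              pref_best q (budget J c (S \<omega>)) = list_best (P \<omega>) (budget J c (S \<omega>))}
             \<subseteq> set_pmf (\<kappa> (P \<omega>, S \<omega>)) \<longrightarrow>
           set_pmf (\<kappa>\<^sub>j (P \<omega>, S \<omega>)) = local_set_weak J c E j (S \<omega>) (P \<omega>)) \<and>
        ((\<forall>\<omega>\<in>space M. strong_partial_order K (P \<omega>) (Q \<omega>)) \<longrightarrow>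
         (AE \<omega> in M.
           {q \<in> prefs J. strong_partial_order K (P \<omega>) q \<and>
              pref_best q (budget J c (S \<omega>)) = list_best (P \<omega>) (budget J c (S \<omega>))}
             \<subseteq> set_pmf (\<kappa> (P \<omega>, S \<omega>)) \<longrightarrow>
           set_pmf (\<kappa>\<^sub>j (P \<omega>, S \<omega>)) = local_set_strong J K c E j (S \<omega>) (P \<omega>))))"
proof -
  have tied: "tied J c E j (S \<omega>)" if "\<omega> \<in> space M" for \<omega>
    using tied_score_class that \<open>j \<in> {1..J}\<close> E by simp
  have Q: "Q \<omega> \<in> prefs J" if "\<omega> \<in> space M" for \<omega>
    using measurable_space[OF \<open>Q \<in> M \<rightarrow>\<^sub>M count_space (prefs J)\<close> that] by simp
  have P: "P \<omega> \<in> lists_upto J K" if "\<omega> \<in> space M" for \<omega>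
    using measurable_space[OF \<open>P \<in> M \<rightarrow>\<^sub>M count_space (lists_upto J K)\<close> that] by simp
  have match: "pref_best (Q \<omega>) (budget J c (S \<omega>)) = list_best (P \<omega>) (budget J c (S \<omega>))"
    if "\<omega> \<in> space M" for \<omega>
    using match_true match_reported that by simp
  have sound_weak: "true_local J c E (S \<omega>) (Q \<omega>) \<in> local_set_weak J c E j (S \<omega>) (P \<omega>)"
    if "\<omega> \<in> space M" for \<omega>
    using true_local_mem_weak[OF tied Q _ match] weak that by blast
  have sound_strong: "true_local J c E (S \<omega>) (Q \<omega>) \<in> local_set_strong J K c E j (S \<omega>) (P \<omega>)"
    if "\<omega> \<in> space M" "strong_partial_order K (P \<omega>) (Q \<omega>)" for \<omega>
    using true_local_mem_strong[OF tied Q _ _ match] P that by (auto simp: lists_upto_def)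
  note support = sharp_support[OF assms(1,4,5,6)]
  show ?thesis
  proof (intro conjI allI impI ballI; (elim conjE)?)
    fix \<kappa> \<kappa>\<^sub>j
    assume \<kappa>: "cond_pmf_version M (count_space (lists_upto J K) \<Otimes>\<^sub>M score_space J)
          (\<lambda>\<omega>. (P \<omega>, S \<omega>)) Q \<kappa>"
        "cond_pmf_version M (count_space (lists_upto J K) \<Otimes>\<^sub>M score_space J)
          (\<lambda>\<omega>. (P \<omega>, S \<omega>)) (\<lambda>\<omega>. true_local J c E (S \<omega>) (Q \<omega>)) \<kappa>\<^sub>j"
    show "AE \<omega> in M.
           {q \<in> prefs J. weak_partial_order K (P \<omega>) q \<and>
              pref_best q (budget J c (S \<omega>)) = list_best (P \<omega>) (budget J c (S \<omega>))}
             \<subseteq> set_pmf (\<kappa> (P \<omega>, S \<omega>)) \<longrightarrow>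
           set_pmf (\<kappa>\<^sub>j (P \<omega>, S \<omega>)) = local_set_weak J c E j (S \<omega>) (P \<omega>)"
    proof (rule support[OF \<kappa>])
      fix \<omega> x assume \<omega>: "\<omega> \<in> space M" and x: "x \<in> local_set_weak J c E j (S \<omega>) (P \<omega>)"
      show "\<exists>q\<in>prefs J. weak_partial_order K (P \<omega>) q \<and>
        pref_best q (budget J c (S \<omega>)) = list_best (P \<omega>) (budget J c (S \<omega>)) \<and>
        true_local J c E (S \<omega>) q = x"
        by (rule local_set_weak_attained[OF tied[OF \<omega>] P[OF \<omega>] x]) blast
    qed (fact sound_weak local_set_weak_cong[OF \<open>j \<in> {1..J}\<close>])+
    assume strong: "\<forall>\<omega>\<in>space M. strong_partial_order K (P \<omega>) (Q \<omega>)"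
    show "AE \<omega> in M.
           {q \<in> prefs J. strong_partial_order K (P \<omega>) q \<and>
              pref_best q (budget J c (S \<omega>)) = list_best (P \<omega>) (budget J c (S \<omega>))}
             \<subseteq> set_pmf (\<kappa> (P \<omega>, S \<omega>)) \<longrightarrow>
           set_pmf (\<kappa>\<^sub>j (P \<omega>, S \<omega>)) = local_set_strong J K c E j (S \<omega>) (P \<omega>)"
    proof (rule support[OF \<kappa>])
      fix \<omega> x assume \<omega>: "\<omega> \<in> space M" and x: "x \<in> local_set_strong J K c E j (S \<omega>) (P \<omega>)"
      \<comment> \<open>The student's own preference \<open>Q \<omega>\<close> takes the role of
        \<open>q0\<close>, which settles lists shorter than \<open>K\<close>.\<close>
      have "strong_partial_order K (P \<omega>) (Q \<omega>)" using strong \<omega> by blast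
      then show "\<exists>q\<in>prefs J. strong_partial_order K (P \<omega>) q \<and>
        pref_best q (budget J c (S \<omega>)) = list_best (P \<omega>) (budget J c (S \<omega>)) \<and>
        true_local J c E (S \<omega>) q = x"
        by (rule local_set_strong_attained[OF tied[OF \<omega>] P[OF \<omega>] Q[OF \<omega>] _ match[OF \<omega>] x]) blast
    next
      show "true_local J c E (S \<omega>) (Q \<omega>) \<in> local_set_strong J K c E j (S \<omega>) (P \<omega>)"
        if "\<omega> \<in> space M" for \<omega>
        using sound_strong strong that by blast
    qed (fact local_set_strong_cong[OF \<open>j \<in> {1..J}\<close>])
  qed (use sound_weak sound_strong in auto)
qed

end
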